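(* Let $H>2$ be an integer and let $\alpha,\mu,\delta>0$ be real numbers with $(\alpha+\mu)\delta<1$. With $N(p,\gamma)$, $Q(p,\gamma)$ and $u^*(p,\gamma)=N(p,\gamma)/Q(p,\gamma)$ as defined in the context, consider the cubic polynomial in $\gamma$ $$K(\gamma) := \frac{\partial N}{\partial p}(1,\gamma)\,Q(1,\gamma) - N(1,\gamma)\,\frac{\partial Q}{\partial p}(1,\gamma).$$ Then $K$ has a unique zero-crossing greater than $1$: there is exactly one real number $\overline\gamma_K>1$ with $K(\overline\gamma_K)=0$, and $K$ changes sign there. This $\overline\gamma_K$ is the threshold governing the transition from sure to probabilistic sniping, i.e. $$\left.\frac{\partial u^*}{\partial p}(p,\gamma)\right|_{p=1}>0 \ \text{ for } 1\le\gamma<\overline\gamma_K, \qquad \left.\frac{\partial u^*}{\partial p}(p,\gamma)\right|_{p=1}<0 \ \text{ for } \gamma>\overline\gamma_K .$$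
   Context: Parameters: an integer $H>2$ (number of high-frequency traders), real $\alpha,\mu,\delta>0$ (news arrival rate, liquidity-trader arrival rate, exchange latency) with $(\alpha+\mu)\delta<1$, and risk aversion $\gamma\ge 1$. Put $$\overline\alpha=\frac{\alpha\delta}{2},\quad \overline\mu=\frac{\mu\delta}{2},\quad \beta=\frac{\alpha}{\alpha+\mu},\quad q=\gamma-1,\quad m=1-\overline\mu,\quad \overline\theta=\frac{2\,\overline\alpha\,\overline\mu}{\overline\alpha+\overline\mu}.$$ For a sniping probability $p\in(0,1]$ define $$h(p)=\frac{(1-p)^H-(1-Hp)}{Hp},\qquad g(p)=\frac{h(p)}{(H-1)p};$$ both are polynomials in $p$ (after cancellation), and are extended accordingly to $p=0$ (so $h(0)=0$, $g(0)=\tfrac12$) and to all real $p$, so that derivatives at the endpoints make sense. Define $$A(p,\gamma)=m\beta\,p\,g(p),\qquad B(p,\gamma)=-\overline\alpha\, q\,\beta\, p\,g(p),$$ $$C(p,\gamma)=-\bigl\{q\overline\theta+\beta(m\gamma-\overline\mu q)\,h(p)\bigr\},\qquad D(p,\gamma)=(1+\overline\mu)-\beta\bigl(m+\overline\alpha q\,h(p)\bigr).$$ As functions of the spread $s\in[0,1]$, the expected utilities of a bandit and of the market maker are $A(1-s)+Bs$ and $C(1-s)+Ds$. With $$N=AD-BC,\qquad Q=(A-C)+(D-B),$$ the utility at the intersection of these two lines (the point of indifference) is $u^*(p,\gamma)=N(p,\gamma)/Q(p,\gamma)$. The case $p=1$ is called sure sniping, $0<p<1$ probabilistic sniping. The transition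 from sure to probabilistic sniping is defined as the change of sign of $\partial u^*/\partial p$ at $p=1$ from positive (sure sniping) to negative (probabilistic sniping) as $\gamma$ increases. *)

theory Defs
  imports "HOL-Analysis.Analysis" "HOL-Computational_Algebra.Polynomial"
begin

definition alpha_bar :: "real \<Rightarrow> real \<Rightarrow> real" where
  "alpha_bar \<alpha> \<delta> = \<alpha> * \<delta> / 2"

definition mu_bar :: "real \<Rightarrow> real \<Rightarrow> real" where
  "mu_bar \<mu> \<delta> = \<mu> * \<delta> / 2"

definition beta :: "real \<Rightarrow> real \<Rightarrow> real" where
  "beta \<alpha> \<mu> = \<alpha> / (\<alpha> + \<mu>)"

definition m_coef :: "real \<Rightarrow> real \<Rightarrow> real" where
  "m_coef \<mu> \<delta> = 1 - mu_bar \<mu> \<delta>"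

definition theta_bar :: "real \<Rightarrow> real \<Rightarrow> real \<Rightarrow> real" where
  "theta_bar \<alpha> \<mu> \<delta> =
     2 * alpha_bar \<alpha> \<delta> * mu_bar \<mu> \<delta> / (alpha_bar \<alpha> \<delta> + mu_bar \<mu> \<delta>)"

text \<open>
  The quotients defining h and g cancel to polynomials in p. The value prescribed at
  p = 0 is the value of these polynomials there, so that the functions below are the
  polynomials on the whole real line; see \<open>h_fun_eq_poly\<close> and \<open>g_fun_eq_poly\<close>.
\<close>

definition h_fun :: "nat \<Rightarrow> real \<Rightarrow> real" where
  "h_fun H p =
     (if p = 0 then 0 else ((1 - p) ^ H - (1 - real H * p)) / (real H * p))"

definition g_fun :: "nat \<Rightarrow> real \<Rightarrow> real" where
  "g_fun H p = (if p = 0 then 1 / 2 else h_fun H p / ((real H - 1) * p))"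

lemma h_fun_numerator:
  fixes p :: real
  assumes "H \<ge> 2"
  shows "(1 - p) ^ H - (1 - real H * p) =
    (\<Sum>k = 2..H. real (H choose k) * (-1) ^ k * p ^ k)"
proof -
  have "(1 - p) ^ H = (\<Sum>k\<le>H. real (H choose k) * (- p) ^ k)"
    using binomial_ring[of "- p" 1 H] by simp
  also have "\<dots> = (\<Sum>k\<le>H. real (H choose k) * (-1) ^ k * p ^ k)"
    by (intro sum.cong refl) (simp add: power_minus[of p])
  also have "{..H} = {0, 1} \<union> {2..H}"
    using assms by auto
  also have "(\<Sum>k \<in> {0, 1} \<union> {2..H}. real (H choose k) * (-1) ^ k * p ^ k) =
      1 - real H * p + (\<Sum>k = 2..H. real (H choose k) * (-1) ^ k * p ^ k)"
    by (subst sum.union_disjoint) auto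
  finally show ?thesis by simp
qed

lemma h_fun_eq_poly:
  assumes "H \<ge> 2"
  shows "h_fun H p =
    (\<Sum>k = 2..H. real (H choose k) * (-1) ^ k * p ^ (k - 1)) / real H"
proof (cases "p = 0")
  case True
  then show ?thesis by (simp add: h_fun_def power_0_left)
next
  case False
  have "(\<Sum>k = 2..H. real (H choose k) * (-1) ^ k * p ^ k) =
      p * (\<Sum>k = 2..H. real (H choose k) * (-1) ^ k * p ^ (k - 1))"
    unfolding sum_distrib_left
    by (intro sum.cong refl) (simp add: power_eq_if)
  then show ?thesis
    using False by (simp add: h_fun_def h_fun_numerator[OF assms])
qed

lemma g_fun_eq_poly:
  assumes "H \<ge> 2"
  shows "g_fun H p =
    (\<Sum>k = 2..H. real (H choose k) * (-1) ^ k * p ^ (k - 2)) / (real H * (real H - 1))"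
proof (cases "p = 0")
  case True
  have "(\<Sum>k = 2..H. real (H choose k) * (-1) ^ k * (0::real) ^ (k - 2)) =
      (\<Sum>k \<in> {2}. real (H choose k) * (-1) ^ k * (0::real) ^ (k - 2))"
    using assms by (intro sum.mono_neutral_right) auto
  also have "\<dots> = real H * (real H - 1) / 2"
    using assms by (simp add: choose_two real_of_nat_div of_nat_diff)
  finally show ?thesis
    using True assms by (simp add: g_fun_def)
next
  case False
  have "(\<Sum>k = 2..H. real (H choose k) * (-1) ^ k * p ^ (k - 1)) =
      p * (\<Sum>k = 2..H. real (H choose k) * (-1) ^ k * p ^ (k - 2))"
    unfolding sum_distrib_left
    by (intro sum.cong refl)
       (auto simp: numeral_2_eq_2 power_Suc[symmetric] Suc_diff_Suc simp del: power_Suc)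
  then show ?thesis
    using False by (simp add: g_fun_def h_fun_eq_poly[OF assms])
qed

text \<open>
  At spread s, the bandit has expected utility \<open>A (1 - s) + B s\<close> and the market maker
  \<open>C (1 - s) + D s\<close>; \<open>u_star = N / Q\<close> is the common value where these two lines meet.
  The risk aversion is \<open>\<gamma>\<close>; the quantity \<open>q = \<gamma> - 1\<close> is written out. A does not depend on \<open>\<gamma>\<close>.
\<close>

definition A_fun :: "nat \<Rightarrow> real \<Rightarrow> real \<Rightarrow> real \<Rightarrow> real \<Rightarrow> real \<Rightarrow> real" where
  "A_fun H \<alpha> \<mu> \<delta> p \<gamma> = m_coef \<mu> \<delta> * beta \<alpha> \<mu> * p * g_fun H p"

definition B_fun :: "nat \<Rightarrow> real \<Rightarrow> real \<Rightarrow> real \<Rightarrow> real \<Rightarrow> real \<Rightarrow> real" where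
  "B_fun H \<alpha> \<mu> \<delta> p \<gamma> = - alpha_bar \<alpha> \<delta> * (\<gamma> - 1) * beta \<alpha> \<mu> * p * g_fun H p"

definition C_fun :: "nat \<Rightarrow> real \<Rightarrow> real \<Rightarrow> real \<Rightarrow> real \<Rightarrow> real \<Rightarrow> real" where
  "C_fun H \<alpha> \<mu> \<delta> p \<gamma> =
     - ((\<gamma> - 1) * theta_bar \<alpha> \<mu> \<delta> +
        beta \<alpha> \<mu> * (m_coef \<mu> \<delta> * \<gamma> - mu_bar \<mu> \<delta> * (\<gamma> - 1)) * h_fun H p)"

definition D_fun :: "nat \<Rightarrow> real \<Rightarrow> real \<Rightarrow> real \<Rightarrow> real \<Rightarrow> real \<Rightarrow> real" where
  "D_fun H \<alpha> \<mu> \<delta> p \<gamma> =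
     (1 + mu_bar \<mu> \<delta>) -
     beta \<alpha> \<mu> * (m_coef \<mu> \<delta> + alpha_bar \<alpha> \<delta> * (\<gamma> - 1) * h_fun H p)"

definition N_fun :: "nat \<Rightarrow> real \<Rightarrow> real \<Rightarrow> real \<Rightarrow> real \<Rightarrow> real \<Rightarrow> real" where
  "N_fun H \<alpha> \<mu> \<delta> p \<gamma> =
     A_fun H \<alpha> \<mu> \<delta> p \<gamma> * D_fun H \<alpha> \<mu> \<delta> p \<gamma> -
     B_fun H \<alpha> \<mu> \<delta> p \<gamma> * C_fun H \<alpha> \<mu> \<delta> p \<gamma>"

definition Q_fun :: "nat \<Rightarrow> real \<Rightarrow> real \<Rightarrow> real \<Rightarrow> real \<Rightarrow> real \<Rightarrow> real" where
  "Q_fun H \<alpha> \<mu> \<delta> p \<gamma> =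
     (A_fun H \<alpha> \<mu> \<delta> p \<gamma> - C_fun H \<alpha> \<mu> \<delta> p \<gamma>) +
     (D_fun H \<alpha> \<mu> \<delta> p \<gamma> - B_fun H \<alpha> \<mu> \<delta> p \<gamma>)"

definition u_star :: "nat \<Rightarrow> real \<Rightarrow> real \<Rightarrow> real \<Rightarrow> real \<Rightarrow> real \<Rightarrow> real" where
  "u_star H \<alpha> \<mu> \<delta> p \<gamma> = N_fun H \<alpha> \<mu> \<delta> p \<gamma> / Q_fun H \<alpha> \<mu> \<delta> p \<gamma>"

definition K_fun :: "nat \<Rightarrow> real \<Rightarrow> real \<Rightarrow> real \<Rightarrow> real \<Rightarrow> real" where
  "K_fun H \<alpha> \<mu> \<delta> \<gamma> =
     deriv (\<lambda>p. N_fun H \<alpha> \<mu> \<delta> p \<gamma>) 1 * Q_fun H \<alpha> \<mu> \<delta> 1 \<gamma> -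
     N_fun H \<alpha> \<mu> \<delta> 1 \<gamma> * deriv (\<lambda>p. Q_fun H \<alpha> \<mu> \<delta> p \<gamma>) 1"

definition changes_sign_at :: "(real \<Rightarrow> real) \<Rightarrow> real \<Rightarrow> bool" where
  "changes_sign_at f c \<longleftrightarrow>
     (eventually (\<lambda>x. f x > 0) (at_left c) \<and> eventually (\<lambda>x. f x < 0) (at_right c)) \<or>
     (eventually (\<lambda>x. f x < 0) (at_left c) \<and> eventually (\<lambda>x. f x > 0) (at_right c))"

end

theory Submission imports Defs begin

text \<open>
  Since \<open>p g(p) = h(p) / (H - 1)\<close>, both N and Q depend on p only through \<open>x = h(p)\<close>: N is
  a quadratic in x without constant term and Q is affine in x. With \<open>h'(1) = 1 / H\<close> the chain rule
  makes K a positive multiple of a cubic \<open>c0 + c1 q - c2 q^2 - c3 q^3\<close> in \<open>q = \<gamma> - 1\<close>,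
  where \<open>c0, c2, c3 > 0\<close>. Whatever the sign of \<open>c1\<close>, the coefficients change sign exactly once,
  so there is one positive root. As \<open>Q > 0\<close> for \<open>q \<ge> 0\<close>, the derivative of \<open>u_star\<close>
  has the sign of K.
\<close>

text \<open>Dividing \<open>f x\<close> by \<open>x > 0\<close> turns the term of unknown sign into
  the constant \<open>c1\<close> and leaves a strictly decreasing function, so at most one positive
  root exists; the intermediate value theorem provides one.\<close>

lemma cubic_unique_positive_root:
  fixes c0 c1 c2 c3 :: real
  defines "f \<equiv> \<lambda>x. c0 + c1 * x - c2 * x^2 - c3 * x^3"
  assumes c: "c0 > 0" "c2 \<ge> 0" "c3 > 0"
  obtains r where "r > 0" "f r = 0" "\<And>x. 0 \<le> x \<Longrightarrow> x < r \<Longrightarrow> f x > 0" "\<And>x. r < x \<Longrightarrow> f x < 0"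
proof -
  \<comment> \<open>A point where the cubic term dominates: as \<open>X \<ge> 1\<close>, the terms
    in \<open>c0\<close> and \<open>c1\<close> are at most
    \<open>(c0 + \<bar>c1\<bar>) * X^2\<close>, so \<open>f X\<close> is at most
    \<open>- c3 * X^2\<close>.\<close>
  define X where "X = 1 + (c0 + \<bar>c1\<bar>) / c3"
  have X1: "X \<ge> 1" using c by (simp add: X_def)
  have "c3 * X = c3 + c0 + \<bar>c1\<bar>" using c by (simp add: X_def field_simps)
  hence neg: "X^2 * (c0 + \<bar>c1\<bar> - c3 * X) < 0"
    using c X1 by (intro mult_pos_neg) auto
  have "X \<le> X^2" "1 \<le> X^2" using X1 by (auto simp: self_le_power)
  hence "\<bar>c1\<bar> * X \<le> \<bar>c1\<bar> * X^2" "c0 * 1 \<le> c0 * X^2"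
    using c by (intro mult_left_mono; simp)+
  moreover have "c1 * X \<le> \<bar>c1\<bar> * X" using X1 by (intro mult_right_mono) auto
  moreover have "c2 * X^2 \<ge> 0" using c by simp
  ultimately have "f X \<le> X^2 * (c0 + \<bar>c1\<bar> - c3 * X)"
    unfolding f_def by (simp add: algebra_simps power2_eq_square power3_eq_cube)
  with neg have "f X \<le> 0" by linarith
  moreover have "f 0 > 0" using c by (simp add: f_def)
  moreover have "continuous_on {0..X} f" unfolding f_def by (intro continuous_intros)
  ultimately obtain r where r: "0 \<le> r" "f r = 0"
    using IVT2'[of f X 0 0] X1 by auto
  have "r \<noteq> 0" using r \<open>f 0 > 0\<close> by auto
  with r have r0: "r > 0" by simp
  \<comment> \<open>\<open>f x / x\<close> is strictly decreasing on the positive half-line\<close>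
  have dec: "y * f x - x * f y > 0" if "0 \<le> x" "x < y" for x y
  proof -
    \<comment> \<open>Cleared of denominators, the comparison also covers \<open>x = 0\<close>; the
      \<open>c1\<close> terms cancel.\<close>
    have "y * f x - x * f y = (y - x) * (c0 + c2 * (x * y) + c3 * (x * y * (x + y)))"
      unfolding f_def by (simp add: algebra_simps power2_eq_square power3_eq_cube)
    also have "\<dots> > 0"
      using that c by (intro mult_pos_pos add_pos_nonneg) auto
    finally show ?thesis .
  qed
  show thesis
  proof (rule that[OF r0 r(2)])
    show "f x > 0" if "0 \<le> x" "x < r" for x
      using dec[OF that] r(2) r0 by (simp add: zero_less_mult_iff)
    show "f x < 0" if "r < x" for x
      using dec[of r x] that r(2) r0 by (simp add: mult_less_0_iff)
  qed
qed

text \<open>Eliminates g, leaving h as the only source of dependence on p. At \<open>p = 0\<close>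
  both sides vanish.\<close>

lemma mult_g_fun: "p * g_fun H p = h_fun H p / (real H - 1)"
  by (simp add: g_fun_def h_fun_def)

lemma h_fun_1: "H > 0 \<Longrightarrow> h_fun H 1 = (real H - 1) / real H"
  by (simp add: h_fun_def)

text \<open>Near 1 the quotient formula applies, and \<open>(1 - p) ^ H\<close> has derivative 0 at
  1 because \<open>H \<ge> 2\<close>.\<close>

lemma has_real_derivative_h_fun_1:
  assumes "H \<ge> 2"
  shows "(h_fun H has_real_derivative 1 / real H) (at 1)"
proof -
  have deriv: "((\<lambda>p. ((1 - p) ^ H - (1 - real H * p)) / (real H * p)) has_real_derivative 1 / real H) (at 1)"
    using assms by (auto intro!: derivative_eq_intros simp: field_simps power_0_left)
  have "\<forall>\<^sub>F p in nhds (1::real). p \<noteq> 0"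
    by (rule t1_space_nhds) simp
  hence ev: "\<forall>\<^sub>F p in nhds (1::real). ((1 - p) ^ H - (1 - real H * p)) / (real H * p) = h_fun H p"
    by eventually_elim (simp add: h_fun_def)
  show ?thesis
    using deriv DERIV_cong_ev[OF refl ev refl] by simp
qed

text \<open>The common shape of N (with \<open>a = 0\<close>) and Q (with \<open>c = 0\<close>);
  both are written below with explicit zero terms to match it.\<close>

lemma quadratic_in_h_has_derivative_1:
  assumes "H \<ge> 2"
  shows "((\<lambda>p. a + b * h_fun H p + c * (h_fun H p)^2) has_real_derivative
     (b + 2 * c * ((real H - 1) / real H)) / real H) (at 1)"
  using assms
  by (auto intro!: derivative_eq_intros has_real_derivative_h_fun_1 simp: h_fun_1 field_simps)

theorem proposition1:
  fixes H :: nat and \<alpha> \<mu> \<delta> :: real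
  assumes "H > 2" and "\<alpha> > 0" and "\<mu> > 0" and "\<delta> > 0" and "(\<alpha> + \<mu>) * \<delta> < 1"
  shows "(\<exists>P :: real poly. degree P = 3 \<and> (\<forall>\<gamma>. K_fun H \<alpha> \<mu> \<delta> \<gamma> = poly P \<gamma>)) \<and>
    (\<exists>\<gamma>\<^sub>K > 1.
      K_fun H \<alpha> \<mu> \<delta> \<gamma>\<^sub>K = 0 \<and>
      (\<forall>\<gamma> > 1. K_fun H \<alpha> \<mu> \<delta> \<gamma> = 0 \<longrightarrow> \<gamma> = \<gamma>\<^sub>K) \<and>
      changes_sign_at (K_fun H \<alpha> \<mu> \<delta>) \<gamma>\<^sub>K \<and>
      (\<forall>\<gamma>. 1 \<le> \<gamma> \<and> \<gamma> < \<gamma>\<^sub>K \<longrightarrow>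
        (\<lambda>p. u_star H \<alpha> \<mu> \<delta> p \<gamma>) field_differentiable (at 1) \<and>
        deriv (\<lambda>p. u_star H \<alpha> \<mu> \<delta> p \<gamma>) 1 > 0) \<and>
      (\<forall>\<gamma>. \<gamma>\<^sub>K < \<gamma> \<longrightarrow>
        (\<lambda>p. u_star H \<alpha> \<mu> \<delta> p \<gamma>) field_differentiable (at 1) \<and>
        deriv (\<lambda>p. u_star H \<alpha> \<mu> \<delta> p \<gamma>) 1 < 0))"
proof -
  define n where "n = real H - 1"
  define a where "a = alpha_bar \<alpha> \<delta>"
  define u where "u = mu_bar \<mu> \<delta>"
  define b where "b = beta \<alpha> \<mu>"
  define m where "m = 1 - u"
  \<comment> \<open>With \<open>q = \<gamma> - 1\<close>, the factor
    \<open>m * \<gamma> - u * q\<close> in C equals \<open>m + w * q\<close>; \<open>E\<close> below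
    is the part of D free of h.\<close>
  define w where "w = 1 - 2 * u"
  define E where "E = 1 + u - b * m"
  define k0 where "k0 = b * m * (1 / n + 1)"
  define k1 where "k1 = b * (w - a + a / n)"
  define x where "x = (real H - 1) / real H"
  define n0 where "n0 = (\<lambda>q. m * E - 2 * u * a * b * q^2)"
  define n1 where "n1 = (\<lambda>q. a * b * q * (2 * m + w * q))"
  define Q0 where "Q0 = (\<lambda>q. E + 2 * u * b * q)"
  define Q1 where "Q1 = (\<lambda>q. k0 + k1 * q)"

  have n: "n > 1" using assms by (simp add: n_def)
  have a: "a > 0" and u: "u > 0" using assms by (auto simp: a_def u_def alpha_bar_def mu_bar_def)
  \<comment> \<open>The latency bound in halved form. It gives \<open>w > 2 * a\<close>, whence
    \<open>w > a\<close> and the positivity of \<open>k1\<close>.\<close>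
  have "a + u < 1/2"
    using assms by (simp add: a_def u_def alpha_bar_def mu_bar_def field_simps)
  hence m: "m > 0" "m < 1" and w: "w > 0" "w > a"
    using a u by (auto simp: m_def w_def)
  have b: "b > 0" "b < 1" using assms by (auto simp: b_def beta_def)
  have "b * m < 1 * 1" using b m by (intro mult_strict_mono) auto
  hence E: "E > 0" using u by (simp add: E_def)
  have k: "k0 > 0" "k1 > 0"
    using b m n w a by (auto simp: k0_def k1_def intro!: mult_pos_pos add_pos_pos)
  have x: "x > 0" using assms by (simp add: x_def)
  \<comment> \<open>The factor \<open>\<delta> / 2\<close> cancels in \<open>a / (a + u)\<close>,
    which is therefore \<open>b\<close>.\<close>
  have theta: "theta_bar \<alpha> \<mu> \<delta> = 2 * u * b"
  proof -
    have "\<alpha> * \<delta> / 2 + \<mu> * \<delta> / 2 = (\<alpha> + \<mu>) * \<delta> / 2" "\<alpha> + \<mu> \<noteq> 0" "\<delta> \<noteq> 0"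
      using assms by (auto simp: algebra_simps add_divide_distrib)
    thus ?thesis
      by (simp add: theta_bar_def u_def b_def beta_def alpha_bar_def mu_bar_def)
  qed
  have m_coef: "m_coef \<mu> \<delta> = m"
    by (simp add: m_coef_def m_def u_def)

  note simps = A_fun_def B_fun_def C_fun_def D_fun_def mult_g_fun mult.assoc theta m_coef
    n_def[symmetric] a_def[symmetric] u_def[symmetric] b_def[symmetric]
  have N: "N_fun H \<alpha> \<mu> \<delta> p \<gamma> =
      0 + (b / n * n0 (\<gamma> - 1)) * h_fun H p + (- (b / n * n1 (\<gamma> - 1))) * (h_fun H p)^2" for p \<gamma>
    using n unfolding N_fun_def simps n0_def n1_def E_def m_def w_def
    by (simp add: field_simps power2_eq_square)
  have Q: "Q_fun H \<alpha> \<mu> \<delta> p \<gamma> =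
      Q0 (\<gamma> - 1) + Q1 (\<gamma> - 1) * h_fun H p + 0 * (h_fun H p)^2" for p \<gamma>
    using n unfolding Q_fun_def simps Q0_def Q1_def k0_def k1_def E_def m_def w_def
    by (simp add: field_simps)
  have dN: "((\<lambda>p. N_fun H \<alpha> \<mu> \<delta> p \<gamma>) has_real_derivative
      (b / n * n0 (\<gamma> - 1) + 2 * (- (b / n * n1 (\<gamma> - 1))) * x) / real H) (at 1)" for \<gamma>
    unfolding N x_def using assms by (intro quadratic_in_h_has_derivative_1) auto
  have dQ: "((\<lambda>p. Q_fun H \<alpha> \<mu> \<delta> p \<gamma>) has_real_derivative
      (Q1 (\<gamma> - 1) + 2 * 0 * x) / real H) (at 1)" for \<gamma>
    unfolding Q x_def using assms by (intro quadratic_in_h_has_derivative_1) auto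
  have h1: "h_fun H 1 = x" using assms by (simp add: h_fun_1 x_def)

  \<comment> \<open>Coefficients, by powers of q, of
    \<open>n0 * Q0 - 2 * x * n1 * Q0 - x^2 * n1 * Q1\<close>. Only \<open>c1\<close> mixes
    signs.\<close>
  define c0 where "c0 = m * E^2"
  define c1 where "c1 = 2 * u * b * m * E - 4 * x * m * a * b * E - 2 * x^2 * m * a * b * k0"
  define c2 where "c2 = 2 * u * a * b * E + 2 * x * (a * b * w * E + 4 * m * a * b^2 * u)
    + x^2 * (a * b * w * k0 + 2 * m * a * b * k1)"
  define c3 where "c3 = 4 * u^2 * a * b^2 + 4 * x * a * b^2 * u * w + x^2 * a * b * w * k1"
  define f where "f = (\<lambda>q. c0 + c1 * q - c2 * q^2 - c3 * q^3)"
  define \<kappa> where "\<kappa> = b / (n * real H)"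
  have c: "c0 > 0" "c2 > 0" "c3 > 0"
    using a u b m w E k x by (auto simp: c0_def c2_def c3_def intro!: add_pos_pos mult_pos_pos)
  have \<kappa>: "\<kappa> > 0" using b n assms by (simp add: \<kappa>_def)

  have K: "K_fun H \<alpha> \<mu> \<delta> \<gamma> = \<kappa> * f (\<gamma> - 1)" for \<gamma>
  proof -
    define q where "q = \<gamma> - 1"
    \<comment> \<open>The products \<open>n0 * Q1\<close> cancel between the two halves of K;
      \<open>\<kappa>\<close> collects \<open>b / n\<close> from N and \<open>1 / H\<close> from the
      derivative of h.\<close>
    have "K_fun H \<alpha> \<mu> \<delta> \<gamma> =
        \<kappa> * (n0 q * Q0 q - 2 * x * (n1 q * Q0 q) - x^2 * (n1 q * Q1 q))"
      using n assms(1)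
      unfolding K_fun_def DERIV_imp_deriv[OF dN] DERIV_imp_deriv[OF dQ]
      unfolding N Q h1 q_def[symmetric] \<kappa>_def
      by (simp add: field_simps power2_eq_square)
    also have "n0 q * Q0 q - 2 * x * (n1 q * Q0 q) - x^2 * (n1 q * Q1 q) = f q"
      unfolding n0_def n1_def Q0_def Q1_def f_def c0_def c1_def c2_def c3_def
      by (simp add: algebra_simps power2_eq_square power3_eq_cube)
    finally show ?thesis by (simp add: q_def)
  qed

  obtain r where r: "r > 0" "f r = 0" "\<And>y. 0 \<le> y \<Longrightarrow> y < r \<Longrightarrow> f y > 0" "\<And>y. r < y \<Longrightarrow> f y < 0"
    using cubic_unique_positive_root[OF c(1) less_imp_le[OF c(2)] c(3), of c1] unfolding f_def by blast
  have Kpos: "K_fun H \<alpha> \<mu> \<delta> \<gamma> > 0" if "1 \<le> \<gamma>" "\<gamma> < 1 + r" for \<gamma>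
    using r(3)[of "\<gamma> - 1"] that \<kappa> by (simp add: K)
  have Kneg: "K_fun H \<alpha> \<mu> \<delta> \<gamma> < 0" if "1 + r < \<gamma>" for \<gamma>
    using r(4)[of "\<gamma> - 1"] that \<kappa> by (simp add: K mult_less_0_iff)
  have Kzero: "K_fun H \<alpha> \<mu> \<delta> (1 + r) = 0"
    using r(2) by (simp add: K)

  have du: "((\<lambda>p. u_star H \<alpha> \<mu> \<delta> p \<gamma>) has_real_derivative
      K_fun H \<alpha> \<mu> \<delta> \<gamma> / (Q_fun H \<alpha> \<mu> \<delta> 1 \<gamma>)^2) (at 1)"
    and Qpos: "Q_fun H \<alpha> \<mu> \<delta> 1 \<gamma> > 0" if "\<gamma> \<ge> 1" for \<gamma>
  proof -
    \<comment> \<open>For \<open>\<gamma> \<ge> 1\<close> every term of Q is nonnegative and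
      \<open>E > 0\<close>; the quotient rule below needs Q nonzero.\<close>
    show Q': "Q_fun H \<alpha> \<mu> \<delta> 1 \<gamma> > 0"
      using that E u b k x unfolding Q h1 Q0_def Q1_def
      by (auto intro!: add_pos_nonneg mult_nonneg_nonneg add_nonneg_nonneg)
    show "((\<lambda>p. u_star H \<alpha> \<mu> \<delta> p \<gamma>) has_real_derivative
        K_fun H \<alpha> \<mu> \<delta> \<gamma> / (Q_fun H \<alpha> \<mu> \<delta> 1 \<gamma>)^2) (at 1)"
      using DERIV_divide[OF dN[of \<gamma>] dQ[of \<gamma>]] Q'
      unfolding u_star_def K_fun_def DERIV_imp_deriv[OF dN] DERIV_imp_deriv[OF dQ]
      by (simp add: power2_eq_square)
  qed

  \<comment> \<open>The cubic in q with \<open>\<gamma> - 1\<close> substituted; a linear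
    substitution keeps the degree, and the leading coefficient \<open>- \<kappa> * c3\<close> is
    nonzero.\<close>
  define P where "P = pcompose (smult \<kappa> [:c0, c1, - c2, - c3:]) [:-1, 1:]"
  have "degree P = 3" using \<kappa> c by (simp add: P_def degree_pcompose)
  moreover have "K_fun H \<alpha> \<mu> \<delta> \<gamma> = poly P \<gamma>" for \<gamma>
  proof -
    define q where "q = \<gamma> - 1"
    show ?thesis
      unfolding K P_def f_def poly_pcompose
      by (simp add: q_def[symmetric] algebra_simps power2_eq_square power3_eq_cube)
  qed
  moreover have "changes_sign_at (K_fun H \<alpha> \<mu> \<delta>) (1 + r)"
  proof -
    have "\<forall>\<^sub>F \<gamma> in at_left (1 + r). K_fun H \<alpha> \<mu> \<delta> \<gamma> > 0"
      using r(1) Kpos unfolding eventually_at_left_field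
      by (intro exI[of _ 1]) auto
    moreover have "\<forall>\<^sub>F \<gamma> in at_right (1 + r). K_fun H \<alpha> \<mu> \<delta> \<gamma> < 0"
      using Kneg unfolding eventually_at_right_field
      by (intro exI[of _ "2 + r"]) auto
    ultimately show ?thesis by (simp add: changes_sign_at_def)
  qed
  moreover have "\<gamma> = 1 + r" if "\<gamma> > 1" "K_fun H \<alpha> \<mu> \<delta> \<gamma> = 0" for \<gamma>
    using Kpos[of \<gamma>] Kneg[of \<gamma>] that by force
  moreover have "(\<lambda>p. u_star H \<alpha> \<mu> \<delta> p \<gamma>) field_differentiable (at 1)" if "\<gamma> \<ge> 1" for \<gamma>
    using du[OF that] by (auto simp: field_differentiable_def)
  moreover have "deriv (\<lambda>p. u_star H \<alpha> \<mu> \<delta> p \<gamma>) 1 > 0" if "1 \<le> \<gamma>" "\<gamma> < 1 + r" for \<gamma>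
    using Kpos[OF that] Qpos[OF that(1)] DERIV_imp_deriv[OF du[OF that(1)]] by simp
  moreover have "deriv (\<lambda>p. u_star H \<alpha> \<mu> \<delta> p \<gamma>) 1 < 0" if "1 + r < \<gamma>" for \<gamma>
    using Kneg[OF that] Qpos[of \<gamma>] DERIV_imp_deriv[OF du[of \<gamma>]] that r(1)
    by (simp add: divide_neg_pos)
  ultimately show ?thesis
    using r(1) Kzero by (intro conjI exI[of _ P] exI[of _ "1 + r"]) auto
qed

end
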